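(* Consider the semidefinite programs $(\mathrm{SDP1})$ and $(\mathrm{SDP2})$ (SDP relaxations of the circle packing problem) defined in the context, and in each case let $\gamma^*$ denote the optimal (maximum) value of $\gamma$. (i) The optimal value of $(\mathrm{SDP1})$ is $\gamma^*=1+\frac1{n-1}$ for all $n\ge 2$. (ii) The optimal value of $(\mathrm{SDP2})$ is $\gamma^*=\frac14\Big(1+\frac1{\lfloor (n-1)/4\rfloor}\Big)$ for all $n\ge 5$. Furthermore, adding the first-level RLT constraints (defined in the context) to $(\mathrm{SDP1})$, respectively to $(\mathrm{SDP2})$, does not improve these bounds; that is, the optimal values remain those given in (i) for all $n\ge2$ and in (ii) for all $n\ge5$, respectively.
   Context: Write $[n]=\{1,\dots,n\}$. The circle packing problem is: maximize $\gamma$ over $x,y\in[0,1]^n$, $\gamma\in\mathbb{R}$ subject to $(x_j-x_i)^2+(y_j-y_i)^2\ge\gamma$ for all $1\le i<j\le n$. Let $n_x=\lceil n/2\rceil$ and $n_y=\lceil n_x/2\rceil$. Put $u_i=\frac12$ for $1\le i\le n_x$ and $u_i=1$ for $n_x<i\le n$; put $v_i=\frac12$ for $1\le i\le n_y$ and $v_i=1$ for $n_y<i\le n$. Variables are $x,y\in\mathbb{R}^n$ (column vectors), symmetric real $n\times n$ matrices $X,Y$, and $\gamma\in\mathbb{R}$; $A\succeq B$ means $A-B$ is positive semidefinite. In both problems $\gamma$ is maximized. $(\mathrm{SDP1})$: subject to $X_{ii}-2X_{ij}+X_{jj}+Y_{ii}-2Y_{ij}+Y_{jj}\ge\gamma$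 for all $1\le i<j\le n$; $X\succeq xx^T$, $Y\succeq yy^T$; $X_{ii}\le x_i$, $Y_{ii}\le y_i$ for $i\in[n]$; $x,y\in[0,1]^n$. $(\mathrm{SDP2})$: the same as $(\mathrm{SDP1})$, except that the constraints $X_{ii}\le x_i$, $Y_{ii}\le y_i$ are replaced by $X_{ii}\le u_ix_i$ and $Y_{ii}\le v_iy_i$ for $i\in[n]$. First-level RLT constraints for $(\mathrm{SDP1})$: $X_{ij}\ge0$, $X_{ij}\ge x_i+x_j-1$, $Y_{ij}\ge0$, $Y_{ij}\ge y_i+y_j-1$ for all $1\le i<j\le n$. First-level RLT constraints for $(\mathrm{SDP2})$ (the images of the constraints $X_{ij}\ge0$, $X_{ij}\ge x_i+x_j-1$, $Y_{ij}\ge0$, $Y_{ij}\ge y_i+y_j-1$ for all $1\le i<j\le n$ under the scaling to the boxes $\prod_i[0,u_i]$ and $\prod_i[0,v_i]$): $X_{ij}\ge0$, $X_{ij}\ge u_jx_i+u_ix_j-u_iu_j$, $Y_{ij}\ge0$, $Y_{ij}\ge v_jy_i+v_iy_j-v_iv_j$ for all $1\le i<j\le n$. *)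

theory Defs
  imports Complex_Main "Jordan_Normal_Form.Matrix"
begin

text \<open>
  Vectors and matrices are indexed from 0, so the index set
  $\{1,\dots,n\}$ becomes $\{0,\dots,n-1\}$ and $1 \le i \le k$ becomes \<open>i < k\<close>.
\<close>

definition symmetric_mat :: "real mat \<Rightarrow> bool" where
  "symmetric_mat A \<longleftrightarrow> transpose_mat A = A"

definition psd :: "real mat \<Rightarrow> bool" where
  "psd A \<longleftrightarrow> square_mat A \<and> symmetric_mat A \<and>
     (\<forall>v \<in> carrier_vec (dim_row A). 0 \<le> v \<bullet> (A *\<^sub>v v))"

definition loewner_ge :: "real mat \<Rightarrow> real mat \<Rightarrow> bool" (infix \<open>\<succeq>\<close> 50) where
  "A \<succeq> B \<longleftrightarrow> psd (A - B)"

definition outer_square :: "real vec \<Rightarrow> real mat" where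
  "outer_square x = mat (dim_vec x) (dim_vec x) (\<lambda>(i, j). x $ i * x $ j)"

definition n_x :: "nat \<Rightarrow> nat" where
  "n_x n = nat \<lceil>real n / 2\<rceil>"

definition n_y :: "nat \<Rightarrow> nat" where
  "n_y n = nat \<lceil>real (n_x n) / 2\<rceil>"

definition u_bound :: "nat \<Rightarrow> nat \<Rightarrow> real" where
  "u_bound n i = (if i < n_x n then 1 / 2 else 1)"

definition v_bound :: "nat \<Rightarrow> nat \<Rightarrow> real" where
  "v_bound n i = (if i < n_y n then 1 / 2 else 1)"

definition sdp_common ::
  "nat \<Rightarrow> real vec \<Rightarrow> real vec \<Rightarrow> real mat \<Rightarrow> real mat \<Rightarrow> real \<Rightarrow> bool" where
  "sdp_common n x y X Y \<gamma> \<longleftrightarrow>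
     x \<in> carrier_vec n \<and> y \<in> carrier_vec n \<and>
     X \<in> carrier_mat n n \<and> Y \<in> carrier_mat n n \<and>
     symmetric_mat X \<and> symmetric_mat Y \<and>
     (\<forall>i j. i < j \<and> j < n \<longrightarrow>
        X $$ (i, i) - 2 * X $$ (i, j) + X $$ (j, j)
          + Y $$ (i, i) - 2 * Y $$ (i, j) + Y $$ (j, j) \<ge> \<gamma>) \<and>
     X \<succeq> outer_square x \<and> Y \<succeq> outer_square y \<and>
     (\<forall>i<n. x $ i \<in> {0..1} \<and> y $ i \<in> {0..1})"

definition SDP1 ::
  "nat \<Rightarrow> real vec \<Rightarrow> real vec \<Rightarrow> real mat \<Rightarrow> real mat \<Rightarrow> real \<Rightarrow> bool" where
  "SDP1 n x y X Y \<gamma> \<longleftrightarrow> sdp_common n x y X Y \<gamma> \<and>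
     (\<forall>i<n. X $$ (i, i) \<le> x $ i \<and> Y $$ (i, i) \<le> y $ i)"

definition SDP2 ::
  "nat \<Rightarrow> real vec \<Rightarrow> real vec \<Rightarrow> real mat \<Rightarrow> real mat \<Rightarrow> real \<Rightarrow> bool" where
  "SDP2 n x y X Y \<gamma> \<longleftrightarrow> sdp_common n x y X Y \<gamma> \<and>
     (\<forall>i<n. X $$ (i, i) \<le> u_bound n i * x $ i \<and> Y $$ (i, i) \<le> v_bound n i * y $ i)"

definition RLT1 :: "nat \<Rightarrow> real vec \<Rightarrow> real vec \<Rightarrow> real mat \<Rightarrow> real mat \<Rightarrow> bool" where
  "RLT1 n x y X Y \<longleftrightarrow> (\<forall>i j. i < j \<and> j < n \<longrightarrow>
     X $$ (i, j) \<ge> 0 \<and> X $$ (i, j) \<ge> x $ i + x $ j - 1 \<and>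
     Y $$ (i, j) \<ge> 0 \<and> Y $$ (i, j) \<ge> y $ i + y $ j - 1)"

definition RLT2 :: "nat \<Rightarrow> real vec \<Rightarrow> real vec \<Rightarrow> real mat \<Rightarrow> real mat \<Rightarrow> bool" where
  "RLT2 n x y X Y \<longleftrightarrow> (\<forall>i j. i < j \<and> j < n \<longrightarrow>
     X $$ (i, j) \<ge> 0 \<and>
     X $$ (i, j) \<ge> u_bound n j * x $ i + u_bound n i * x $ j - u_bound n i * u_bound n j \<and>
     Y $$ (i, j) \<ge> 0 \<and>
     Y $$ (i, j) \<ge> v_bound n j * y $ i + v_bound n i * y $ j - v_bound n i * v_bound n j)"

definition SDP1_RLT ::
  "nat \<Rightarrow> real vec \<Rightarrow> real vec \<Rightarrow> real mat \<Rightarrow> real mat \<Rightarrow> real \<Rightarrow> bool" where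
  "SDP1_RLT n x y X Y \<gamma> \<longleftrightarrow> SDP1 n x y X Y \<gamma> \<and> RLT1 n x y X Y"

definition SDP2_RLT ::
  "nat \<Rightarrow> real vec \<Rightarrow> real vec \<Rightarrow> real mat \<Rightarrow> real mat \<Rightarrow> real \<Rightarrow> bool" where
  "SDP2_RLT n x y X Y \<gamma> \<longleftrightarrow> SDP2 n x y X Y \<gamma> \<and> RLT2 n x y X Y"

text \<open>
  \<open>\<gamma>\<close> is an attained maximum, not merely a supremum, of the objective over
  the feasible region \<open>F\<close>.
\<close>

definition is_optimal_value ::
  "(real vec \<Rightarrow> real vec \<Rightarrow> real mat \<Rightarrow> real mat \<Rightarrow> real \<Rightarrow> bool) \<Rightarrow> real \<Rightarrow> bool" where
  "is_optimal_value F \<gamma> \<longleftrightarrow> (\<exists>x y X Y. F x y X Y \<gamma>) \<and>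
     (\<forall>x y X Y \<gamma>'. F x y X Y \<gamma>' \<longrightarrow> \<gamma>' \<le> \<gamma>)"

end

theory Submission
  imports Defs "HOL-Analysis.Convex"
begin

text \<open>
  Restrict the problem to the first \<open>m\<close> indices, where \<open>X\<^sub>i\<^sub>i \<le> c x\<^sub>i\<close> and \<open>Y\<^sub>i\<^sub>i \<le> c y\<^sub>i\<close>, and put
  \<open>s = \<Sum>\<^sub>i x\<^sub>i\<close>. Testing \<open>X \<succeq> xx\<^sup>T\<close> with the indicator vector \<open>e\<close> of these indices gives
  \<open>m tr X - e\<^sup>T X e \<le> m c s - s\<^sup>2 \<le> m\<^sup>2 c\<^sup>2 / 4\<close>; summing the distance constraints then yields
  \<open>\<gamma> \<le> c\<^sup>2 m / (m - 1)\<close>. For SDP1 take \<open>m = n\<close>, \<open>c = 1\<close>; for SDP2 take \<open>m = n\<^sub>y = \<lceil>n / 4\<rceil>\<close>, \<open>c = 1/2\<close>.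

  The bound is attained at the centre of the box, \<open>x\<^sub>i = u\<^sub>i / 2\<close>, where all RLT lower bounds
  vanish: let \<open>X - xx\<^sup>T\<close> have diagonal entries \<open>u\<^sub>i\<^sup>2 / 4\<close>, off-diagonal entries
  \<open>- u\<^sub>i u\<^sub>j / (4 (m - 1))\<close> for \<open>i, j\<close> among the first \<open>m\<close> indices, and zeros elsewhere.
\<close>

section \<open>Semidefinite constraints as scalar inequalities\<close>

lemma sum_indicator_lessThan:
  fixes g :: "nat \<Rightarrow> real"
  assumes "m \<le> n"
  shows "(\<Sum>i<n. (if i < m then 1 else 0) * g i) = (\<Sum>i<m. g i)"
proof -
  have "(\<Sum>i<n. (if i < m then 1 else 0) * g i) = (\<Sum>i<m. (if i < m then 1 else 0) * g i)"
    by (rule sum.mono_neutral_right) (use assms in auto)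
  then show ?thesis
    by simp
qed

text \<open>Expanding the quadratic form of \<open>X - outer_square x\<close> gives one inequality
  per test vector. Test vectors become functions on \<open>nat\<close>, of which only the values
  below \<open>n\<close> count, so that both directions of use are plain sum manipulation.\<close>

lemma loewner_ge_outer_square_iff:
  assumes X: "X \<in> carrier_mat n n" "symmetric_mat X" and x: "x \<in> carrier_vec n"
  shows "X \<succeq> outer_square x \<longleftrightarrow>
    (\<forall>f. (\<Sum>i<n. f i * x $ i)\<^sup>2 \<le> (\<Sum>i<n. \<Sum>j<n. f i * f j * X $$ (i, j)))"
proof -
  have O: "outer_square x \<in> carrier_mat n n"
    using x by (auto simp: outer_square_def)
  have sym_X: "X $$ (i, j) = X $$ (j, i)" if "i < n" "j < n" for i j
    using X that by (metis carrier_matD index_transpose_mat(1) symmetric_mat_def)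
  have sq: "square_mat (X - outer_square x)"
    using O by auto
  have sym: "symmetric_mat (X - outer_square x)"
    unfolding symmetric_mat_def
    using X x sym_X by (intro eq_matI) (auto simp: outer_square_def)
  have dim: "dim_row (X - outer_square x) = n"
    using O by auto
  have quad: "v \<bullet> ((X - outer_square x) *\<^sub>v v) =
      (\<Sum>i<n. \<Sum>j<n. v $ i * v $ j * X $$ (i, j)) - (\<Sum>i<n. v $ i * x $ i)\<^sup>2"
    if v: "v \<in> carrier_vec n" for v
  proof -
    have "v \<bullet> ((X - outer_square x) *\<^sub>v v) =
        (\<Sum>i<n. v $ i * (\<Sum>j<n. (X $$ (i, j) - x $ i * x $ j) * v $ j))"
      using X x v by (simp add: scalar_prod_def outer_square_def lessThan_atLeast0)
    also have "\<dots> = (\<Sum>i<n. \<Sum>j<n. v $ i * v $ j * X $$ (i, j))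
        - (\<Sum>i<n. \<Sum>j<n. (v $ i * x $ i) * (v $ j * x $ j))"
      by (simp add: sum_distrib_left sum_subtractf[symmetric] algebra_simps)
    also have "(\<Sum>i<n. \<Sum>j<n. (v $ i * x $ i) * (v $ j * x $ j)) = (\<Sum>i<n. v $ i * x $ i)\<^sup>2"
      by (simp add: power2_eq_square sum_product)
    finally show ?thesis .
  qed
  have "X \<succeq> outer_square x \<longleftrightarrow> (\<forall>v \<in> carrier_vec n.
      (\<Sum>i<n. v $ i * x $ i)\<^sup>2 \<le> (\<Sum>i<n. \<Sum>j<n. v $ i * v $ j * X $$ (i, j)))"
    unfolding loewner_ge_def psd_def dim using sq sym quad by simp
  also have "\<dots> \<longleftrightarrow> (\<forall>f. (\<Sum>i<n. f i * x $ i)\<^sup>2 \<le> (\<Sum>i<n. \<Sum>j<n. f i * f j * X $$ (i, j)))"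
    (is "?L \<longleftrightarrow> ?R")
  proof
    assume ?L
    show ?R
    proof
      fix f
      show "(\<Sum>i<n. f i * x $ i)\<^sup>2 \<le> (\<Sum>i<n. \<Sum>j<n. f i * f j * X $$ (i, j))"
        using bspec[OF \<open>?L\<close>, of "vec n f"] by simp
    qed
  qed auto
  finally show ?thesis .
qed

section \<open>Upper bound by averaging pairwise distances\<close>

lemma sum_sq_dist_le:
  assumes X: "X \<in> carrier_mat n n" "symmetric_mat X" and x: "x \<in> carrier_vec n"
    and ge: "X \<succeq> outer_square x" and m: "m \<le> n"
    and diag: "\<And>i. i < m \<Longrightarrow> X $$ (i, i) \<le> c * x $ i"
  shows "(\<Sum>i<m. \<Sum>j<m. X $$ (i, i) - 2 * X $$ (i, j) + X $$ (j, j)) \<le> (real m * c)\<^sup>2 / 2"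
proof -
  define s where "s = (\<Sum>i<m. x $ i)"
  define e where "e = (\<lambda>i. if i < m then 1 else 0 :: real)"
  have cut: "(\<Sum>i<n. e i * g i) = (\<Sum>i<m. g i)" for g
    unfolding e_def by (rule sum_indicator_lessThan[OF m])
  have "(\<Sum>i<n. e i * x $ i)\<^sup>2 \<le> (\<Sum>i<n. \<Sum>j<n. e i * e j * X $$ (i, j))"
    using loewner_ge_outer_square_iff[OF X x] ge by blast
  then have quad: "s\<^sup>2 \<le> (\<Sum>i<m. \<Sum>j<m. X $$ (i, j))"
    by (simp add: cut s_def mult.assoc flip: sum_distrib_left)
  have "(\<Sum>i<m. X $$ (i, i)) \<le> (\<Sum>i<m. c * x $ i)"
    by (rule sum_mono) (simp add: diag)
  then have trace: "real m * (\<Sum>i<m. X $$ (i, i)) \<le> real m * (c * s)"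
    by (simp add: s_def mult_left_mono flip: sum_distrib_left)
  have "(\<Sum>i<m. \<Sum>j<m. X $$ (i, i) - 2 * X $$ (i, j) + X $$ (j, j)) =
      2 * (real m * (\<Sum>i<m. X $$ (i, i))) - 2 * (\<Sum>i<m. \<Sum>j<m. X $$ (i, j))"
    by (simp add: sum.distrib sum_subtractf flip: sum_distrib_left)
  also have "\<dots> \<le> 2 * (real m * (c * s)) - 2 * s\<^sup>2"
    using quad trace by simp
  \<comment> \<open>The gap is \<open>(2 * s - real m * c)\<^sup>2 / 2\<close>, so the unknown
    \<open>s\<close> drops out; equality would force the mean of the \<open>x $ i\<close> to be
    \<open>c / 2\<close>.\<close>
  also have "\<dots> \<le> (real m * c)\<^sup>2 / 2"
    using zero_le_power2[of "2 * s - real m * c"] by (simp add: power2_eq_square algebra_simps)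
  finally show ?thesis .
qed

lemma sdp_common_upper_bound:
  assumes F: "sdp_common n x y X Y \<gamma>" and m: "2 \<le> m" "m \<le> n"
    and dX: "\<And>i. i < m \<Longrightarrow> X $$ (i, i) \<le> c * x $ i"
    and dY: "\<And>i. i < m \<Longrightarrow> Y $$ (i, i) \<le> c * y $ i"
  shows "\<gamma> \<le> c\<^sup>2 * (1 + 1 / (real m - 1))"
proof -
  define d where "d = (\<lambda>A i j. A $$ (i, i) - 2 * A $$ (i, j) + A $$ (j, j) :: real)"
  have X: "X \<in> carrier_mat n n" "symmetric_mat X" "x \<in> carrier_vec n" "X \<succeq> outer_square x"
    and Y: "Y \<in> carrier_mat n n" "symmetric_mat Y" "y \<in> carrier_vec n" "Y \<succeq> outer_square y"
    and g: "\<And>i j. i < j \<Longrightarrow> j < n \<Longrightarrow> \<gamma> \<le> d X i j + d Y i j"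
    using F by (auto simp: sdp_common_def d_def algebra_simps)
  have d_sym: "d A i j = d A j i" if "A \<in> carrier_mat n n" "symmetric_mat A" "i < n" "j < n" for A i j
    using that unfolding d_def symmetric_mat_def
    by (metis (no_types, lifting) add.commute add_diff_eq carrier_matD diff_add_eq index_transpose_mat(1))
  \<comment> \<open>Since \<open>d\<close> vanishes on the diagonal, cancelling
    \<open>\<gamma>\<close> there lets the sum run over the full square of indices, where each of
    the m(m-1) ordered pairs counts once.\<close>
  have pair: "\<gamma> - (if j = i then \<gamma> else 0) \<le> d X i j + d Y i j" if "i < m" "j < m" for i j
  proof (cases i j rule: linorder_cases)
    case greater
    then show ?thesis
      using g[of j i] d_sym[OF X(1,2), of i j] d_sym[OF Y(1,2), of i j] that m by simp
  qed (use g[of i j] that m in \<open>auto simp: d_def\<close>)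
  have "\<gamma> * (real m * (real m - 1)) = (\<Sum>i<m. \<Sum>j<m. \<gamma> - (if j = i then \<gamma> else 0))"
    by (simp add: sum_subtractf algebra_simps)
  also have "\<dots> \<le> (\<Sum>i<m. \<Sum>j<m. d X i j + d Y i j)"
    by (intro sum_mono) (simp add: pair)
  also have "\<dots> \<le> (real m * c)\<^sup>2"
    using sum_sq_dist_le[OF X m(2) dX] sum_sq_dist_le[OF Y m(2) dY]
    by (simp add: d_def sum.distrib)
  finally have "real m * (\<gamma> * (real m - 1)) \<le> real m * (c\<^sup>2 * real m)"
    by (simp add: power2_eq_square algebra_simps)
  then have "\<gamma> * (real m - 1) \<le> c\<^sup>2 * real m"
    using m by simp
  then show ?thesis
    using m by (simp add: field_simps)
qed

section \<open>The feasible point at the centre of the box\<close>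

definition centre :: "nat \<Rightarrow> (nat \<Rightarrow> real) \<Rightarrow> real vec" where
  "centre n w = vec n (\<lambda>i. w i / 2)"

text \<open>Up to scaling by \<open>w\<close>, the excess over the entries 1/4 is the Gram matrix of
  the \<open>m\<close> vertices of a regular simplex centred at the origin, with circumradius 1/2,
  together with \<open>n - m\<close> further orthogonal vectors of the same length.\<close>

definition simplex_mat :: "nat \<Rightarrow> nat \<Rightarrow> (nat \<Rightarrow> real) \<Rightarrow> real mat" where
  "simplex_mat n m w = mat n n (\<lambda>(i, j). w i * w j *
     (if i = j then 1 / 2
      else if i < m \<and> j < m then 1 / 4 - 1 / (4 * (real m - 1))
      else 1 / 4))"

lemma symmetric_simplex_mat: "symmetric_mat (simplex_mat n m w)"
  unfolding symmetric_mat_def by (rule eq_matI) (auto simp: simplex_mat_def)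

lemma simplex_mat_loewner_ge:
  assumes m: "2 \<le> m" "m \<le> n"
  shows "simplex_mat n m w \<succeq> outer_square (centre n w)"
proof -
  have "(\<Sum>i<n. f i * centre n w $ i)\<^sup>2 \<le> (\<Sum>i<n. \<Sum>j<n. f i * f j * simplex_mat n m w $$ (i, j))"
    for f
  proof -
    define g where "g = (\<lambda>i. f i * w i)"
    define t where "t = 1 / (real m - 1)"
    define e where "e = (\<lambda>i. if i < m then 1 else 0 :: real)"
    have cut: "(\<Sum>i<n. e i * h i) = (\<Sum>i<m. h i)" for h
      unfolding e_def by (rule sum_indicator_lessThan[OF m(2)])
    \<comment> \<open>Rank one plus diagonal minus rank one on the block. The extra \<open>t\<close>
      on the diagonal undoes what the last term subtracts there, so the double sum collapses to
      squares.\<close>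
    have entry: "f i * f j * simplex_mat n m w $$ (i, j) =
        g i * g j / 4 + (if j = i then (g i)\<^sup>2 / 4 + t * (e i * (g i)\<^sup>2) / 4 else 0)
        - t * ((e i * g i) * (e j * g j)) / 4"
      if "i < n" "j < n" for i j
      using that by (auto simp: simplex_mat_def g_def t_def e_def power2_eq_square algebra_simps)
    have "(\<Sum>i<n. \<Sum>j<n. f i * f j * simplex_mat n m w $$ (i, j)) =
        (\<Sum>i<n. \<Sum>j<n. g i * g j / 4 + (if j = i then (g i)\<^sup>2 / 4 + t * (e i * (g i)\<^sup>2) / 4 else 0)
        - t * ((e i * g i) * (e j * g j)) / 4)"
      by (intro sum.cong refl) (simp add: entry)
    also have "\<dots> = (\<Sum>i<n. g i)\<^sup>2 / 4 + ((\<Sum>i<n. (g i)\<^sup>2) + t * (\<Sum>i<n. e i * (g i)\<^sup>2)) / 4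
        - t * (\<Sum>i<n. e i * g i)\<^sup>2 / 4"
      by (simp add: sum.distrib sum_subtractf power2_eq_square sum_product add_divide_distrib
          flip: sum_distrib_left sum_divide_distrib)
    also have "\<dots> = (\<Sum>i<n. g i)\<^sup>2 / 4 + ((\<Sum>i<n. (g i)\<^sup>2) + t * (\<Sum>i<m. (g i)\<^sup>2)) / 4
        - t * (\<Sum>i<m. g i)\<^sup>2 / 4"
      by (simp add: cut)
    finally have eq: "(\<Sum>i<n. \<Sum>j<n. f i * f j * simplex_mat n m w $$ (i, j)) = \<dots>" .
    \<comment> \<open>Cauchy-Schwarz is exactly enough, because m * t = 1 + t.\<close>
    have "(\<Sum>i<m. g i)\<^sup>2 \<le> real m * (\<Sum>i<m. (g i)\<^sup>2)"
      using sum_squared_le_sum_of_squares[of g "{..<m}"] by (simp add: mult.commute)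
    then have "t * (\<Sum>i<m. g i)\<^sup>2 \<le> t * (real m * (\<Sum>i<m. (g i)\<^sup>2))"
      using m by (intro mult_left_mono) (auto simp: t_def)
    also have "\<dots> = (\<Sum>i<m. (g i)\<^sup>2) + t * (\<Sum>i<m. (g i)\<^sup>2)"
      using m by (simp add: t_def field_simps)
    also have "\<dots> \<le> (\<Sum>i<n. (g i)\<^sup>2) + t * (\<Sum>i<m. (g i)\<^sup>2)"
      using m by (intro add_right_mono sum_mono2) auto
    finally have le: "t * (\<Sum>i<m. g i)\<^sup>2 \<le> (\<Sum>i<n. (g i)\<^sup>2) + t * (\<Sum>i<m. (g i)\<^sup>2)" .
    have "(\<Sum>i<n. f i * centre n w $ i) = (\<Sum>i<n. g i) / 2"
      by (simp add: centre_def g_def sum_divide_distrib)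
    then have "(\<Sum>i<n. f i * centre n w $ i)\<^sup>2 = (\<Sum>i<n. g i)\<^sup>2 / 4"
      by (simp only: power_divide) simp
    then show ?thesis
      unfolding eq using le by argo
  qed
  then show ?thesis
    by (subst loewner_ge_outer_square_iff[of _ n])
      (simp_all add: symmetric_simplex_mat, simp_all add: simplex_mat_def centre_def)
qed

text \<open>The right-hand side of \<open>dist\<close> is the squared distance evaluated at the
  simplex point. As \<open>i < j\<close>, testing \<open>j < m\<close> alone decides whether both
  indices lie in the block.\<close>

lemma sdp_common_witness:
  assumes m: "2 \<le> m" "m \<le> n"
    and u: "\<And>i. i < n \<Longrightarrow> u i \<in> {0..1}" and v: "\<And>i. i < n \<Longrightarrow> v i \<in> {0..1}"
    and dist: "\<And>i j. i < j \<Longrightarrow> j < n \<Longrightarrow> \<gamma> \<le>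
      ((u i)\<^sup>2 + (u j)\<^sup>2 + (v i)\<^sup>2 + (v j)\<^sup>2 - (u i * u j + v i * v j)) / 2
      + (if j < m then (u i * u j + v i * v j) / (2 * (real m - 1)) else 0)"
  shows "sdp_common n (centre n u) (centre n v) (simplex_mat n m u) (simplex_mat n m v) \<gamma>"
proof -
  have "\<gamma> \<le> simplex_mat n m u $$ (i, i) - 2 * simplex_mat n m u $$ (i, j) + simplex_mat n m u $$ (j, j)
      + simplex_mat n m v $$ (i, i) - 2 * simplex_mat n m v $$ (i, j) + simplex_mat n m v $$ (j, j)"
    if "i < j" "j < n" for i j
  proof -
    have "simplex_mat n m w $$ (i, i) - 2 * simplex_mat n m w $$ (i, j) + simplex_mat n m w $$ (j, j)
      = ((w i)\<^sup>2 + (w j)\<^sup>2 - w i * w j) / 2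
        + (if j < m then w i * w j / (2 * (real m - 1)) else 0)" for w
      using that m by (simp add: simplex_mat_def power2_eq_square divide_simps) (simp add: algebra_simps)
    from this[of u] this[of v] dist[OF that] show ?thesis
      by (auto simp: add_divide_distrib diff_divide_distrib)
  qed
  moreover have "centre n w \<in> carrier_vec n" "simplex_mat n m w \<in> carrier_mat n n" for w
    by (simp_all add: centre_def simplex_mat_def)
  moreover have "centre n u $ i \<in> {0..1} \<and> centre n v $ i \<in> {0..1}" if "i < n" for i
    using u[OF that] v[OF that] that by (auto simp: centre_def)
  ultimately show ?thesis
    unfolding sdp_common_def
    using symmetric_simplex_mat simplex_mat_loewner_ge[OF m] by blast
qed

lemma simplex_mat_diag: "i < n \<Longrightarrow> simplex_mat n m w $$ (i, i) = w i * centre n w $ i"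
  by (simp add: simplex_mat_def centre_def)

text \<open>At the centre the second bound evaluates to 0, so both reduce to nonnegativity of the
  entries, which holds as \<open>m - 1\<close> is at least 1.\<close>

lemma simplex_mat_RLT:
  assumes "2 \<le> m" "\<And>i. i < n \<Longrightarrow> 0 \<le> w i" "i < n" "j < n"
  shows "0 \<le> simplex_mat n m w $$ (i, j)"
    and "w j * centre n w $ i + w i * centre n w $ j - w i * w j \<le> simplex_mat n m w $$ (i, j)"
proof -
  have "1 / (4 * (real m - 1)) \<le> 1 / 4"
    using assms by (simp add: field_simps)
  then show "0 \<le> simplex_mat n m w $$ (i, j)"
    using assms by (simp add: simplex_mat_def)
  then show "w j * centre n w $ i + w i * centre n w $ j - w i * w j \<le> simplex_mat n m w $$ (i, j)"
    using assms by (simp add: centre_def)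
qed

section \<open>Optimal value of SDP1\<close>

lemma SDP1_upper_bound:
  assumes "2 \<le> n" "SDP1 n x y X Y \<gamma>"
  shows "\<gamma> \<le> 1 + 1 / (real n - 1)"
  using sdp_common_upper_bound[of n x y X Y \<gamma> n 1] assms by (simp add: SDP1_def)

lemma SDP1_RLT_attained:
  assumes "2 \<le> n"
  shows "\<exists>x y X Y. SDP1_RLT n x y X Y (1 + 1 / (real n - 1))"
proof -
  let ?w = "\<lambda>_. 1 :: real"
  have "sdp_common n (centre n ?w) (centre n ?w) (simplex_mat n n ?w) (simplex_mat n n ?w)
      (1 + 1 / (real n - 1))"
    by (rule sdp_common_witness) (use assms in \<open>auto simp: field_simps\<close>)
  then have "SDP1_RLT n (centre n ?w) (centre n ?w) (simplex_mat n n ?w) (simplex_mat n n ?w)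
      (1 + 1 / (real n - 1))"
    using simplex_mat_RLT[OF assms, of n ?w]
    by (auto simp: SDP1_RLT_def SDP1_def RLT1_def simplex_mat_diag)
  then show ?thesis
    by blast
qed

section \<open>Arithmetic of the block sizes and optimal value of SDP2\<close>

lemma nat_ceiling_half: "nat \<lceil>real k / 2\<rceil> = (k + 1) div 2"
  by linarith

lemma n_x_eq: "n_x n = (n + 1) div 2"
  unfolding n_x_def by (rule nat_ceiling_half)

lemma n_y_eq: "n_y n = (n + 3) div 4"
  unfolding n_y_def n_x_eq nat_ceiling_half by linarith

lemma real_n_y_minus_1:
  assumes "1 \<le> n"
  shows "real (n_y n) - 1 = real_of_int \<lfloor>(real n - 1) / 4\<rfloor>"
proof -
  have "n_y n = (n - 1) div 4 + 1"
    unfolding n_y_eq using assms by linarith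
  moreover have "\<lfloor>(real n - 1) / 4\<rfloor> = int ((n - 1) div 4)"
    using floor_divide_of_nat_eq[of "n - 1" 4] assms by (simp add: of_nat_diff)
  ultimately show ?thesis
    by simp
qed

text \<open>From n = 5 on the block contains a pair; at n = 4 it has a single index. That
  \<open>n_y n\<close> is at most \<open>n_x n\<close> makes both box bounds 1/2 on the
  block.\<close>

lemma n_y_bounds:
  assumes "5 \<le> n"
  shows "2 \<le> n_y n" "n_y n \<le> n_x n" "n_x n \<le> n"
  using assms unfolding n_x_eq n_y_eq by linarith+

lemma SDP2_upper_bound:
  assumes "5 \<le> n" "SDP2 n x y X Y \<gamma>"
  shows "\<gamma> \<le> 1 / 4 * (1 + 1 / (real (n_y n) - 1))"
proof -
  have "\<gamma> \<le> (1 / 2)\<^sup>2 * (1 + 1 / (real (n_y n) - 1))"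
  proof (rule sdp_common_upper_bound[where n = n])
    fix i assume "i < n_y n"
    then show "X $$ (i, i) \<le> 1 / 2 * x $ i" "Y $$ (i, i) \<le> 1 / 2 * y $ i"
      using assms(2) n_y_bounds[OF assms(1)] unfolding SDP2_def u_bound_def v_bound_def
      by (smt (verit, best) order.strict_trans2)+
  qed (use assms n_y_bounds[OF assms(1)] in \<open>auto simp: SDP2_def\<close>)
  then show ?thesis
    by (simp add: power2_eq_square)
qed

lemma SDP2_RLT_attained:
  assumes "5 \<le> n"
  shows "\<exists>x y X Y. SDP2_RLT n x y X Y (1 / 4 * (1 + 1 / (real (n_y n) - 1)))"
proof -
  let ?u = "u_bound n" and ?v = "v_bound n" and ?m = "n_y n"
  note m = n_y_bounds[OF assms]
  have t: "1 / (real ?m - 1) \<le> 1"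
    using m by simp
  have "sdp_common n (centre n ?u) (centre n ?v) (simplex_mat n ?m ?u) (simplex_mat n ?m ?v)
      (1 / 4 * (1 + 1 / (real ?m - 1)))"
  proof (rule sdp_common_witness)
    fix i j assume ij: "i < j" "j < n"
    show "1 / 4 * (1 + 1 / (real ?m - 1)) \<le>
      ((?u i)\<^sup>2 + (?u j)\<^sup>2 + (?v i)\<^sup>2 + (?v j)\<^sup>2 - (?u i * ?u j + ?v i * ?v j)) / 2
      + (if j < ?m then (?u i * ?u j + ?v i * ?v j) / (2 * (real ?m - 1)) else 0)"
    proof (cases "j < ?m")
      case True
      \<comment> \<open>Within the block all four bounds are 1/2 and the constraint is
        tight.\<close>
      then show ?thesis
        using ij m by (simp add: u_bound_def v_bound_def power2_eq_square divide_simps)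
    next
      case False
      \<comment> \<open>Here \<open>?v j\<close> is 1, so the \<open>v\<close> terms give at least
        3/4 and the \<open>u\<close> terms at least 1/4 before halving. By \<open>t\<close> the
        target value is at most 1/2.\<close>
      then have "1 / 2 \<le> ((?u i)\<^sup>2 + (?u j)\<^sup>2 + (?v i)\<^sup>2 + (?v j)\<^sup>2 - (?u i * ?u j + ?v i * ?v j)) / 2"
        using ij m by (auto simp: u_bound_def v_bound_def power2_eq_square)
      then show ?thesis
        using False t by simp
    qed
  qed (use m in \<open>auto simp: u_bound_def v_bound_def\<close>)
  moreover have "0 \<le> ?u i" "0 \<le> ?v i" for i
    by (simp_all add: u_bound_def v_bound_def)
  ultimately have "SDP2_RLT n (centre n ?u) (centre n ?v) (simplex_mat n ?m ?u) (simplex_mat n ?m ?v)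
      (1 / 4 * (1 + 1 / (real ?m - 1)))"
    using simplex_mat_RLT[OF m(1), of n ?u] simplex_mat_RLT[OF m(1), of n ?v]
    by (simp add: SDP2_RLT_def SDP2_def RLT2_def simplex_mat_diag)
  then show ?thesis
    by blast
qed

theorem proposition3:
  "(\<forall>n \<ge> 2. is_optimal_value (SDP1 n) (1 + 1 / (real n - 1))) \<and>
   (\<forall>n \<ge> 5. is_optimal_value (SDP2 n)
      (1 / 4 * (1 + 1 / real_of_int \<lfloor>(real n - 1) / 4\<rfloor>))) \<and>
   (\<forall>n \<ge> 2. is_optimal_value (SDP1_RLT n) (1 + 1 / (real n - 1))) \<and>
   (\<forall>n \<ge> 5. is_optimal_value (SDP2_RLT n)
      (1 / 4 * (1 + 1 / real_of_int \<lfloor>(real n - 1) / 4\<rfloor>)))"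
proof (intro conjI allI impI)
  fix n :: nat
  assume n: "2 \<le> n"
  \<comment> \<open>A point feasible with RLT and a bound valid without RLT settle both problems at
    once.\<close>
  show "is_optimal_value (SDP1 n) (1 + 1 / (real n - 1))"
    unfolding is_optimal_value_def
    using SDP1_RLT_attained[OF n] SDP1_upper_bound[OF n] unfolding SDP1_RLT_def by blast
  show "is_optimal_value (SDP1_RLT n) (1 + 1 / (real n - 1))"
    unfolding is_optimal_value_def
    using SDP1_RLT_attained[OF n] SDP1_upper_bound[OF n] unfolding SDP1_RLT_def by blast
next
  fix n :: nat
  assume n: "5 \<le> n"
  have eq: "real_of_int \<lfloor>(real n - 1) / 4\<rfloor> = real (n_y n) - 1"
    using n real_n_y_minus_1 by simp
  show "is_optimal_value (SDP2 n) (1 / 4 * (1 + 1 / real_of_int \<lfloor>(real n - 1) / 4\<rfloor>))"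
    unfolding is_optimal_value_def eq
    using SDP2_RLT_attained[OF n] SDP2_upper_bound[OF n] unfolding SDP2_RLT_def by blast
  show "is_optimal_value (SDP2_RLT n) (1 / 4 * (1 + 1 / real_of_int \<lfloor>(real n - 1) / 4\<rfloor>))"
    unfolding is_optimal_value_def eq
    using SDP2_RLT_attained[OF n] SDP2_upper_bound[OF n] unfolding SDP2_RLT_def by blast
qed

end
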